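(* There exist cop-win oriented graphs in which, if both the cop and the robber play optimally, the distance between the cop and the robber must strictly increase in two consecutive rounds. That is, in every play of the one-cop game on such a graph in which both agents play optimally, there is some $t$ such that the distance from the cop to the robber after round $t+1$ is strictly larger than after round $t$.
   Context: All graphs are finite. An oriented graph is a directed graph without loops and without parallel or opposite arcs, i.e. a simple undirected graph each of whose edges has been assigned one direction. Game of cops and robbers with one cop on a digraph: first the cop chooses a starting vertex, then the robber chooses a starting vertex. The game proceeds in rounds: in each round the cop either stays in place or moves along an arc (from its tail to its head), after which the robber either stays in place or moves along an arc. All positions are known to both. The cop wins if after finitely many rounds she occupies the same vertex as the robber; otherwise the robber wins. A digraph is cop-win if one cop has a winning strategy. Optimal play means that the cop attempts to win in as few rounds as possible while the robber attempts to prolong his capture as much as possible (all choices, including starting positions, are made accordingly). The distance from the cop to the robber is the length of a shortest directed path from the cop's vertex to the robber's vertex. *)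

theory Defs
  imports "Graph_Theory.Graph_Theory"
begin

locale oriented_graph = pair_digraph +
  assumes no_opposite_arcs: "(u, v) \<in> parcs G \<Longrightarrow> (v, u) \<notin> parcs G"

(* Infimum of the lengths of the directed walks from u to v; infinite if v is not reachable. *)
definition dist_dg :: "'a pair_pre_digraph \<Rightarrow> 'a \<Rightarrow> 'a \<Rightarrow> ereal" where
  "dist_dg G u v = wf_digraph.\<mu> (with_proj G) (\<lambda>_. 1) u v"

definition moves :: "'a pair_pre_digraph \<Rightarrow> 'a \<Rightarrow> 'a set" where
  "moves G u = insert u {v. (u, v) \<in> parcs G}"

(* A history lists the positions (cop, robber) after the initial placement and after each
   completed round, oldest first; [] stands for the situation before the placement.  The robber
   is additionally told the vertex the cop has just chosen. *)
type_synonym 'a history = "('a \<times> 'a) list"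
type_synonym 'a cop_strategy = "'a history \<Rightarrow> 'a"
type_synonym 'a robber_strategy = "'a history \<Rightarrow> 'a \<Rightarrow> 'a"

definition cop_strategies :: "'a pair_pre_digraph \<Rightarrow> 'a cop_strategy set" where
  "cop_strategies G = {\<sigma>. \<sigma> [] \<in> pverts G \<and>
     (\<forall>h \<in> lists (pverts G \<times> pverts G). h \<noteq> [] \<longrightarrow> \<sigma> h \<in> moves G (fst (last h)))}"

definition robber_strategies :: "'a pair_pre_digraph \<Rightarrow> 'a robber_strategy set" where
  "robber_strategies G = {\<tau>. (\<forall>c \<in> pverts G. \<tau> [] c \<in> pverts G) \<and>
     (\<forall>h \<in> lists (pverts G \<times> pverts G). \<forall>c \<in> pverts G.
        h \<noteq> [] \<longrightarrow> \<tau> h c \<in> moves G (snd (last h)))}"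

(* The history of the play after t rounds.  The game ends as soon as the cop and the robber
   share a vertex, possibly in the middle of a round; from then on the position is frozen. *)
primrec play :: "'a cop_strategy \<Rightarrow> 'a robber_strategy \<Rightarrow> nat \<Rightarrow> 'a history" where
  "play \<sigma> \<tau> 0 = [(\<sigma> [], \<tau> [] (\<sigma> []))]"
| "play \<sigma> \<tau> (Suc t) =
     (let h = play \<sigma> \<tau> t; (c, r) = last h; c' = \<sigma> h
      in h @ [if c = r then (c, r) else if c' = r then (c', r) else (c', \<tau> h c')])"

definition cop_at :: "'a cop_strategy \<Rightarrow> 'a robber_strategy \<Rightarrow> nat \<Rightarrow> 'a" where
  "cop_at \<sigma> \<tau> t = fst (last (play \<sigma> \<tau> t))"

definition robber_at :: "'a cop_strategy \<Rightarrow> 'a robber_strategy \<Rightarrow> nat \<Rightarrow> 'a" where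
  "robber_at \<sigma> \<tau> t = snd (last (play \<sigma> \<tau> t))"

definition captured :: "'a cop_strategy \<Rightarrow> 'a robber_strategy \<Rightarrow> nat \<Rightarrow> bool" where
  "captured \<sigma> \<tau> t \<longleftrightarrow> cop_at \<sigma> \<tau> t = robber_at \<sigma> \<tau> t"

definition cop_win :: "'a pair_pre_digraph \<Rightarrow> bool" where
  "cop_win G \<longleftrightarrow> (\<exists>\<sigma> \<in> cop_strategies G. \<forall>\<tau> \<in> robber_strategies G. \<exists>t. captured \<sigma> \<tau> t)"

(* Infinite if the robber is never captured. *)
definition capture_time :: "'a cop_strategy \<Rightarrow> 'a robber_strategy \<Rightarrow> enat" where
  "capture_time \<sigma> \<tau> = (INF t \<in> {t. captured \<sigma> \<tau> t}. enat t)"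

definition optimal_cop :: "'a pair_pre_digraph \<Rightarrow> 'a cop_strategy \<Rightarrow> bool" where
  "optimal_cop G \<sigma> \<longleftrightarrow> \<sigma> \<in> cop_strategies G \<and>
     (\<forall>\<sigma>' \<in> cop_strategies G.
        (SUP \<tau> \<in> robber_strategies G. capture_time \<sigma> \<tau>)
          \<le> (SUP \<tau> \<in> robber_strategies G. capture_time \<sigma>' \<tau>))"

definition optimal_robber :: "'a pair_pre_digraph \<Rightarrow> 'a robber_strategy \<Rightarrow> bool" where
  "optimal_robber G \<tau> \<longleftrightarrow> \<tau> \<in> robber_strategies G \<and>
     (\<forall>\<tau>' \<in> robber_strategies G.
        (INF \<sigma> \<in> cop_strategies G. capture_time \<sigma> \<tau>')
          \<le> (INF \<sigma> \<in> cop_strategies G. capture_time \<sigma> \<tau>))"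

end

theory Submission
  imports Defs
begin

text \<open>The witness has eight vertices. Its only source is 7, so the cop must start there, and optimal
  play continues with cop and robber at \<open>(7, 0)\<close>, \<open>(6, 2)\<close>, \<open>(4, 2)\<close>. At \<open>(6, 2)\<close> the short path
  \<open>6 \<rightarrow> 0 \<rightarrow> 2\<close> is useless: with the cop at 0 the robber steps to 1, and she never catches him.
  She has to go to 4, at distance 3, and on through 3, which guards 1 and its exit 6, to 5, which
  guards both 1 and 2.

  Optimality is only assumed of the whole strategies. If two optimal strategies left the line of
  positions whose values decrease by one in each round, then the opponent could switch to perfect
  play at that point and beat the value of the game.\<close>

section \<open>Positions won within a given number of rounds\<close>

text \<open>The cop is about to move and \<open>k\<close> rounds remain. The disjunct
  \<open>c' = r\<close> is a capture in mid-round, which leaves the robber no reply, in agreement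
  with \<open>play\<close>.\<close>

primrec win :: "'a pair_pre_digraph \<Rightarrow> nat \<Rightarrow> 'a \<Rightarrow> 'a \<Rightarrow> bool" where
  "win G 0 c r \<longleftrightarrow> c = r"
| "win G (Suc k) c r \<longleftrightarrow>
     c = r \<or> (\<exists>c'\<in>moves G c. c' = r \<or> (\<forall>r'\<in>moves G r. win G k c' r'))"

section \<open>Plays, capture and capture time\<close>

lemma last_play: "last (play \<sigma> \<tau> t) = (cop_at \<sigma> \<tau> t, robber_at \<sigma> \<tau> t)"
  by (simp add: cop_at_def robber_at_def)

lemma length_play: "length (play \<sigma> \<tau> t) = Suc t"
  by (induction t) (auto simp: Let_def split: prod.split)

lemma play_neq_Nil: "play \<sigma> \<tau> t \<noteq> []"
  using length_play[of \<sigma> \<tau> t] by auto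

lemma play_Suc:
  "play \<sigma> \<tau> (Suc t) = play \<sigma> \<tau> t @ [(cop_at \<sigma> \<tau> (Suc t), robber_at \<sigma> \<tau> (Suc t))]"
  by (auto simp: cop_at_def robber_at_def Let_def split: prod.split)

lemma cop_at_0: "cop_at \<sigma> \<tau> 0 = \<sigma> []"
  and robber_at_0: "robber_at \<sigma> \<tau> 0 = \<tau> [] (\<sigma> [])"
  by (simp_all add: cop_at_def robber_at_def)

lemma cop_at_Suc:
  "cop_at \<sigma> \<tau> (Suc t) = (if captured \<sigma> \<tau> t then cop_at \<sigma> \<tau> t else \<sigma> (play \<sigma> \<tau> t))"
  by (auto simp: cop_at_def robber_at_def captured_def Let_def split: prod.split)

lemma robber_at_Suc:
  "robber_at \<sigma> \<tau> (Suc t) =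
     (if captured \<sigma> \<tau> t \<or> \<sigma> (play \<sigma> \<tau> t) = robber_at \<sigma> \<tau> t then robber_at \<sigma> \<tau> t
      else \<tau> (play \<sigma> \<tau> t) (\<sigma> (play \<sigma> \<tau> t)))"
  by (auto simp: cop_at_def robber_at_def captured_def Let_def split: prod.split)

lemma captured_mono: "captured \<sigma> \<tau> s \<Longrightarrow> s \<le> t \<Longrightarrow> captured \<sigma> \<tau> t"
proof (induction t)
  case (Suc t)
  then show ?case
    by (cases "s \<le> t") (auto simp: captured_def cop_at_Suc robber_at_Suc le_Suc_eq)
qed simp

text \<open>Capture persists, so the set of rounds at which the robber is captured is upward closed,
  and its infimum is at most \<open>K\<close> exactly if \<open>K\<close> belongs to it. This
  reduces optimality, phrased with suprema and infima, to capture at a fixed round.\<close>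

lemma capture_time_le_iff: "capture_time \<sigma> \<tau> \<le> enat K \<longleftrightarrow> captured \<sigma> \<tau> K"
proof
  assume le: "capture_time \<sigma> \<tau> \<le> enat K"
  show "captured \<sigma> \<tau> K"
  proof (rule ccontr)
    assume "\<not> captured \<sigma> \<tau> K"
    then have "enat (Suc K) \<le> enat t" if "captured \<sigma> \<tau> t" for t
      using that captured_mono[of \<sigma> \<tau> t K] by (simp add: not_less_eq_eq[symmetric]) blast
    then have "enat (Suc K) \<le> capture_time \<sigma> \<tau>"
      unfolding capture_time_def by (auto intro: INF_greatest)
    with le have "enat (Suc K) \<le> enat K"
      by (rule order_trans[rotated])
    then show False by simp
  qed
next
  assume "captured \<sigma> \<tau> K"
  then show "capture_time \<sigma> \<tau> \<le> enat K"
    unfolding capture_time_def by (auto intro: INF_lower)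
qed

text \<open>The placement consults only \<open>[]\<close>, and round \<open>s\<close> consults a
  history of length \<open>s\<close>; histories of length at most \<open>t\<close> thus determine
  the first \<open>t\<close> rounds.\<close>

lemma play_cong_robber:
  assumes "\<And>h c. length h \<le> t \<Longrightarrow> \<tau>' h c = \<tau> h c"
  shows "play \<sigma> \<tau>' t = play \<sigma> \<tau> t"
  using assms
proof (induction t)
  case (Suc t)
  then show ?case by (simp add: length_play Let_def split: prod.split)
qed simp

lemma play_cong_cop:
  assumes "\<And>h. length h \<le> t \<Longrightarrow> \<sigma>' h = \<sigma> h"
  shows "play \<sigma>' \<tau> t = play \<sigma> \<tau> t"
  using assms
proof (induction t)
  case (Suc t)
  then show ?case by (simp add: length_play Let_def split: prod.split)
qed simp

section \<open>Switching to good play in the middle of the game\<close>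

text \<open>After \<open>t\<close> rounds the history has length \<open>t + 1\<close>; hence when a history of length
  \<open>l > t\<close> is completed to the next round, \<open>t + k - l\<close> of the \<open>k\<close> rounds following round \<open>t\<close> remain.\<close>

definition flee ::
    "'a pair_pre_digraph \<Rightarrow> nat \<Rightarrow> nat \<Rightarrow> 'a robber_strategy \<Rightarrow> 'a robber_strategy" where
  "flee G t k \<tau> = (\<lambda>h c. if length h \<le> t then \<tau> h c
     else (let P = (\<lambda>r'. r' \<in> moves G (snd (last h)) \<and> \<not> win G (t + k - length h) c r')
           in if Ex P then Eps P else snd (last h)))"

definition hunt ::
    "'a pair_pre_digraph \<Rightarrow> nat \<Rightarrow> nat \<Rightarrow> 'a cop_strategy \<Rightarrow> 'a cop_strategy" where
  "hunt G t k \<sigma> = (\<lambda>h. if length h \<le> t then \<sigma> h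
     else (let P = (\<lambda>c'. c' \<in> moves G (fst (last h)) \<and>
                (c' = snd (last h) \<or>
                 (\<forall>r'\<in>moves G (snd (last h)). win G (t + k - length h) c' r')))
           in if Ex P then Eps P else fst (last h)))"

lemma play_flee: "play \<sigma> (flee G t k \<tau>) t = play \<sigma> \<tau> t"
  by (rule play_cong_robber) (simp add: flee_def)

lemma play_hunt: "play (hunt G t k \<sigma>) \<tau> t = play \<sigma> \<tau> t"
  by (rule play_cong_cop) (simp add: hunt_def)

context pair_wf_digraph
begin

section \<open>Legality of moves and of the modified strategies\<close>

lemma moves_in_verts: "u \<in> pverts G \<Longrightarrow> v \<in> moves G u \<Longrightarrow> v \<in> pverts G"
  by (auto simp: moves_def dest: in_arcsD2)

lemma self_in_moves: "u \<in> moves G u"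
  by (simp add: moves_def)

lemma play_in_verts:
  assumes "\<sigma> \<in> cop_strategies G" "\<tau> \<in> robber_strategies G"
  shows "play \<sigma> \<tau> t \<in> lists (pverts G \<times> pverts G) \<and>
    cop_at \<sigma> \<tau> t \<in> pverts G \<and> robber_at \<sigma> \<tau> t \<in> pverts G"
proof (induction t)
  case 0
  then show ?case
    using assms by (auto simp: cop_at_0 robber_at_0 cop_strategies_def robber_strategies_def)
next
  case (Suc t)
  let ?h = "play \<sigma> \<tau> t"
  have h: "?h \<in> lists (pverts G \<times> pverts G)" "?h \<noteq> []"
    using Suc by (auto simp: play_neq_Nil)
  have s: "\<sigma> ?h \<in> moves G (cop_at \<sigma> \<tau> t)"
    using assms(1) h by (auto simp: cop_strategies_def cop_at_def)
  then have sv: "\<sigma> ?h \<in> pverts G"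
    using Suc moves_in_verts by blast
  then have "\<tau> ?h (\<sigma> ?h) \<in> moves G (robber_at \<sigma> \<tau> t)"
    using assms(2) h by (auto simp: robber_strategies_def robber_at_def)
  then have "\<tau> ?h (\<sigma> ?h) \<in> pverts G"
    using Suc moves_in_verts by blast
  with sv have "cop_at \<sigma> \<tau> (Suc t) \<in> pverts G" "robber_at \<sigma> \<tau> (Suc t) \<in> pverts G"
    using Suc by (auto simp: cop_at_Suc robber_at_Suc)
  with Suc show ?case by (auto simp: play_Suc simp del: play.simps)
qed

lemma cop_moves:
  assumes "\<sigma> \<in> cop_strategies G" "\<tau> \<in> robber_strategies G"
  shows "\<sigma> (play \<sigma> \<tau> t) \<in> moves G (cop_at \<sigma> \<tau> t)"
  using assms play_in_verts[OF assms, of t]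
  by (auto simp: cop_strategies_def cop_at_def play_neq_Nil)

lemma robber_moves:
  assumes "\<sigma> \<in> cop_strategies G" "\<tau> \<in> robber_strategies G" "c \<in> pverts G"
  shows "\<tau> (play \<sigma> \<tau> t) c \<in> moves G (robber_at \<sigma> \<tau> t)"
  using assms play_in_verts[OF assms(1,2), of t]
  by (auto simp: robber_strategies_def robber_at_def play_neq_Nil)

text \<open>The common shape of \<open>flee\<close> and \<open>hunt\<close>: with \<open>A\<close>
  the legal moves and \<open>x\<close> the current vertex, the choice is legal even on histories
  where no good move exists.\<close>

lemma Eps_or_default:
  assumes "x \<in> A"
  shows "(if \<exists>y. y \<in> A \<and> Q y then SOME y. y \<in> A \<and> Q y else x) \<in> A"
  using assms someI_ex[of "\<lambda>y. y \<in> A \<and> Q y"] by presburger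

lemma flee_in_robber_strategies:
  assumes "\<tau> \<in> robber_strategies G"
  shows "flee G t k \<tau> \<in> robber_strategies G"
  unfolding robber_strategies_def
proof (intro CollectI conjI ballI impI)
  fix c assume c: "c \<in> pverts G"
  show "flee G t k \<tau> [] c \<in> pverts G"
    using assms c by (simp add: flee_def robber_strategies_def)
  fix h assume "h \<in> lists (pverts G \<times> pverts G)" "h \<noteq> []"
  then have "\<tau> h c \<in> moves G (snd (last h))"
    using assms c by (simp add: robber_strategies_def)
  then show "flee G t k \<tau> h c \<in> moves G (snd (last h))"
    unfolding flee_def Let_def
    using Eps_or_default[OF self_in_moves, of "snd (last h)"] by simp
qed

lemma hunt_in_cop_strategies:
  assumes "\<sigma> \<in> cop_strategies G"
  shows "hunt G t k \<sigma> \<in> cop_strategies G"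
  unfolding cop_strategies_def
proof (intro CollectI conjI ballI impI)
  show "hunt G t k \<sigma> [] \<in> pverts G"
    using assms by (simp add: hunt_def cop_strategies_def)
  fix h assume "h \<in> lists (pverts G \<times> pverts G)" "h \<noteq> []"
  then have "\<sigma> h \<in> moves G (fst (last h))"
    using assms by (simp add: cop_strategies_def)
  then show "hunt G t k \<sigma> h \<in> moves G (fst (last h))"
    unfolding hunt_def Let_def
    using Eps_or_default[OF self_in_moves, of "fst (last h)"] by simp
qed

text \<open>Negating the recursion of \<open>win\<close>: no cop move captures at once, and after
  each of them some reply leads to a position not won with one round less. \<open>flee\<close> picks
  such a reply in every round after round \<open>t\<close>.\<close>

lemma flee_not_win:
  assumes "\<sigma> \<in> cop_strategies G" "\<tau> \<in> robber_strategies G"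
    and "\<not> win G k (cop_at \<sigma> \<tau> t) (robber_at \<sigma> \<tau> t)" and "j \<le> k"
  shows "\<not> win G (k - j) (cop_at \<sigma> (flee G t k \<tau>) (t + j)) (robber_at \<sigma> (flee G t k \<tau>) (t + j))"
  using assms(4)
proof (induction j)
  case 0
  then show ?case using assms(3) by (simp add: cop_at_def robber_at_def play_flee)
next
  case (Suc j)
  let ?\<tau> = "flee G t k \<tau>"
  let ?h = "play \<sigma> ?\<tau> (t + j)" and ?r = "robber_at \<sigma> ?\<tau> (t + j)"
  define m where "m = k - Suc j"
  have m: "k - j = Suc m" using Suc.prems by (simp add: m_def)
  have nw: "\<not> win G (Suc m) (cop_at \<sigma> ?\<tau> (t + j)) ?r"
    using Suc m by simp
  have mv: "\<sigma> ?h \<in> moves G (cop_at \<sigma> ?\<tau> (t + j))"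
    by (rule cop_moves[OF assms(1) flee_in_robber_strategies[OF assms(2)]])
  from nw mv have nr: "\<sigma> ?h \<noteq> ?r" and ex: "\<exists>r'. r' \<in> moves G ?r \<and> \<not> win G m (\<sigma> ?h) r'"
    by auto
  have nc: "\<not> captured \<sigma> ?\<tau> (t + j)" using nw by (simp add: captured_def)
  \<comment> \<open>The history \<open>?h\<close> has length \<open>t + j + 1\<close>, so the bound
    used by \<open>flee\<close> is \<open>t + k - (t + j + 1) = m\<close>.\<close>
  have "?\<tau> ?h (\<sigma> ?h) = (SOME r'. r' \<in> moves G ?r \<and> \<not> win G m (\<sigma> ?h) r')"
    using ex by (auto simp: flee_def length_play last_play m_def Let_def)
  then have "\<not> win G m (\<sigma> ?h) (?\<tau> ?h (\<sigma> ?h))"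
    using someI_ex[OF ex] by simp
  then show ?case
    using nc nr by (simp add: cop_at_Suc robber_at_Suc m_def)
qed

lemma not_captured_flee:
  assumes "\<sigma> \<in> cop_strategies G" "\<tau> \<in> robber_strategies G"
    and "\<not> win G k (cop_at \<sigma> \<tau> t) (robber_at \<sigma> \<tau> t)"
  shows "\<not> captured \<sigma> (flee G t k \<tau>) (t + k)"
  using flee_not_win[OF assms, of k] by (simp add: captured_def)

text \<open>The dual of \<open>flee_not_win\<close>: \<open>hunt\<close> picks a move that witnesses
  the recursion of \<open>win\<close>. The first disjunct covers a play frozen by an earlier
  capture, in which \<open>hunt\<close> is no longer followed.\<close>

lemma hunt_win:
  assumes "\<sigma> \<in> cop_strategies G" "\<tau> \<in> robber_strategies G"
    and "win G k (cop_at \<sigma> \<tau> t) (robber_at \<sigma> \<tau> t)" and "j \<le> k"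
  shows "captured (hunt G t k \<sigma>) \<tau> (t + j) \<or>
    win G (k - j) (cop_at (hunt G t k \<sigma>) \<tau> (t + j)) (robber_at (hunt G t k \<sigma>) \<tau> (t + j))"
  using assms(4)
proof (induction j)
  case 0
  then show ?case using assms(3) by (simp add: cop_at_def robber_at_def play_hunt)
next
  case (Suc j)
  let ?\<sigma> = "hunt G t k \<sigma>"
  let ?h = "play ?\<sigma> \<tau> (t + j)" and ?r = "robber_at ?\<sigma> \<tau> (t + j)"
    and ?c = "cop_at ?\<sigma> \<tau> (t + j)"
  define m where "m = k - Suc j"
  have m: "k - j = Suc m" using Suc.prems by (simp add: m_def)
  have \<sigma>: "?\<sigma> \<in> cop_strategies G" by (rule hunt_in_cop_strategies[OF assms(1)])
  show ?case
  proof (cases "captured ?\<sigma> \<tau> (t + j)")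
    case True
    then show ?thesis using captured_mono[of ?\<sigma> \<tau> "t + j" "t + Suc j"] by simp
  next
    case nc: False
    then have "win G (Suc m) ?c ?r" using Suc m by simp
    then have ex: "\<exists>c'. c' \<in> moves G ?c \<and> (c' = ?r \<or> (\<forall>r'\<in>moves G ?r. win G m c' r'))"
      using nc by (auto simp: captured_def)
    have "?\<sigma> ?h = (SOME c'. c' \<in> moves G ?c \<and> (c' = ?r \<or> (\<forall>r'\<in>moves G ?r. win G m c' r')))"
      using ex by (auto simp: hunt_def length_play last_play m_def Let_def)
    then have good: "?\<sigma> ?h = ?r \<or> (\<forall>r'\<in>moves G ?r. win G m (?\<sigma> ?h) r')"
      using someI_ex[OF ex] by simp
    have "?\<sigma> ?h \<in> pverts G"
      using cop_moves[OF \<sigma> assms(2)] play_in_verts[OF \<sigma> assms(2)] moves_in_verts by blast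
    then have "\<tau> ?h (?\<sigma> ?h) \<in> moves G ?r"
      by (rule robber_moves[OF \<sigma> assms(2)])
    then show ?thesis
      using good nc
      by (auto simp: cop_at_Suc robber_at_Suc m_def captured_def)
  qed
qed

lemma captured_hunt:
  assumes "\<sigma> \<in> cop_strategies G" "\<tau> \<in> robber_strategies G"
    and "win G k (cop_at \<sigma> \<tau> t) (robber_at \<sigma> \<tau> t)"
  shows "captured (hunt G t k \<sigma>) \<tau> (t + k)"
  using hunt_win[OF assms, of k] by (auto simp: captured_def)

section \<open>Optimal strategies\<close>

lemma ex_cop_strategy:
  assumes "c \<in> pverts G" and "\<And>r. r \<in> pverts G \<Longrightarrow> win G K c r"
  shows "\<exists>\<sigma>\<in>cop_strategies G. \<forall>\<tau>\<in>robber_strategies G. captured \<sigma> \<tau> K"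
proof -
  \<comment> \<open>This strategy only supplies the starting vertex; \<open>hunt G 0 K\<close> takes
    over on every nonempty history.\<close>
  define \<sigma> :: "'a cop_strategy" where "\<sigma> = (\<lambda>h. if h = [] then c else fst (last h))"
  have \<sigma>: "\<sigma> \<in> cop_strategies G"
    using assms(1) by (auto simp: \<sigma>_def cop_strategies_def self_in_moves)
  have "captured (hunt G 0 K \<sigma>) \<tau> K" if \<tau>: "\<tau> \<in> robber_strategies G" for \<tau>
  proof -
    have "win G K (cop_at \<sigma> \<tau> 0) (robber_at \<sigma> \<tau> 0)"
      using assms(2) play_in_verts[OF \<sigma> \<tau>, of 0] by (simp add: cop_at_0 \<sigma>_def)
    from captured_hunt[OF \<sigma> \<tau> this] show ?thesis by simp
  qed
  then show ?thesis using hunt_in_cop_strategies[OF \<sigma>] by blast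
qed

lemma ex_robber_strategy:
  assumes "\<And>c. c \<in> pverts G \<Longrightarrow> \<exists>r\<in>pverts G. \<not> win G K c r"
  shows "\<exists>\<tau>\<in>robber_strategies G. \<forall>\<sigma>\<in>cop_strategies G. \<not> captured \<sigma> \<tau> K"
proof -
  obtain f where f: "\<And>c. c \<in> pverts G \<Longrightarrow> f c \<in> pverts G \<and> \<not> win G K c (f c)"
    using assms by metis
  \<comment> \<open>The robber sees the cop's vertex before he is placed, so his start may depend on
    it through \<open>f\<close>; afterwards \<open>flee G 0 K\<close> decides.\<close>
  define \<tau> :: "'a robber_strategy" where "\<tau> = (\<lambda>h c. if h = [] then f c else snd (last h))"
  have \<tau>: "\<tau> \<in> robber_strategies G"
    using f by (auto simp: \<tau>_def robber_strategies_def self_in_moves)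
  have "\<not> captured \<sigma> (flee G 0 K \<tau>) K" if \<sigma>: "\<sigma> \<in> cop_strategies G" for \<sigma>
  proof -
    have "\<not> win G K (cop_at \<sigma> \<tau> 0) (robber_at \<sigma> \<tau> 0)"
      using f play_in_verts[OF \<sigma> \<tau>, of 0] by (simp add: cop_at_0 robber_at_0 \<tau>_def)
    from not_captured_flee[OF \<sigma> \<tau> this] show ?thesis by simp
  qed
  then show ?thesis using flee_in_robber_strategies[OF \<tau>] by blast
qed

text \<open>The worst case of an optimal strategy is no worse than that of the strategy assumed to
  capture every robber by round \<open>K\<close>.\<close>

lemma optimal_cop_captures:
  assumes "optimal_cop G \<sigma>" "\<tau> \<in> robber_strategies G"
    and "\<exists>\<sigma>'\<in>cop_strategies G. \<forall>\<tau>\<in>robber_strategies G. captured \<sigma>' \<tau> K"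
  shows "captured \<sigma> \<tau> K"
proof -
  obtain \<sigma>' where \<sigma>': "\<sigma>' \<in> cop_strategies G"
    "\<And>\<tau>. \<tau> \<in> robber_strategies G \<Longrightarrow> captured \<sigma>' \<tau> K"
    using assms(3) by blast
  have "capture_time \<sigma> \<tau> \<le> (SUP \<tau>\<in>robber_strategies G. capture_time \<sigma> \<tau>)"
    using assms(2) by (rule SUP_upper)
  also have "\<dots> \<le> (SUP \<tau>\<in>robber_strategies G. capture_time \<sigma>' \<tau>)"
    using assms(1) \<sigma>'(1) by (auto simp: optimal_cop_def)
  also have "\<dots> \<le> enat K"
    using \<sigma>'(2) by (auto intro!: SUP_least simp: capture_time_le_iff)
  finally show ?thesis by (simp add: capture_time_le_iff)
qed

text \<open>Dual to \<open>optimal_cop_captures\<close>. Escape up to round \<open>K\<close> is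
  written as the bound \<open>enat (Suc K)\<close> from below, a form that passes to the
  infimum.\<close>

lemma optimal_robber_escapes:
  assumes "optimal_robber G \<tau>" "\<sigma> \<in> cop_strategies G"
    and "\<exists>\<tau>'\<in>robber_strategies G. \<forall>\<sigma>\<in>cop_strategies G. \<not> captured \<sigma> \<tau>' K"
  shows "\<not> captured \<sigma> \<tau> K"
proof -
  obtain \<tau>' where \<tau>': "\<tau>' \<in> robber_strategies G"
    "\<And>\<sigma>. \<sigma> \<in> cop_strategies G \<Longrightarrow> \<not> captured \<sigma> \<tau>' K"
    using assms(3) by blast
  have "enat (Suc K) \<le> capture_time \<sigma> \<tau>'" if "\<sigma> \<in> cop_strategies G" for \<sigma>
    using \<tau>'(2)[OF that] capture_time_le_iff[of \<sigma> \<tau>' K]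
    by (metis Suc_ile_eq not_le)
  then have "enat (Suc K) \<le> (INF \<sigma>\<in>cop_strategies G. capture_time \<sigma> \<tau>')"
    by (auto intro: INF_greatest)
  also have "\<dots> \<le> (INF \<sigma>\<in>cop_strategies G. capture_time \<sigma> \<tau>)"
    using assms(1) \<tau>'(1) by (auto simp: optimal_robber_def)
  also have "\<dots> \<le> capture_time \<sigma> \<tau>"
    using assms(2) by (rule INF_lower)
  finally show ?thesis
    by (metis Suc_ile_eq capture_time_le_iff not_le)
qed

text \<open>Otherwise the robber could follow \<open>\<tau>\<close> for \<open>t\<close> rounds and
  then flee, remaining free at round \<open>t + k\<close> against the guarantee of
  \<open>\<sigma>\<close>.\<close>

lemma captures_imp_win:
  assumes "\<sigma> \<in> cop_strategies G" "\<tau> \<in> robber_strategies G"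
    and "\<And>\<tau>. \<tau> \<in> robber_strategies G \<Longrightarrow> captured \<sigma> \<tau> (t + k)"
  shows "win G k (cop_at \<sigma> \<tau> t) (robber_at \<sigma> \<tau> t)"
  using not_captured_flee[OF assms(1,2)] assms(3)[OF flee_in_robber_strategies[OF assms(2)]]
  by blast

text \<open>Otherwise the cop could follow \<open>\<sigma>\<close> for \<open>t\<close> rounds and
  then hunt, with capture by round \<open>t + k\<close>.\<close>

lemma escapes_imp_not_win:
  assumes "\<sigma> \<in> cop_strategies G" "\<tau> \<in> robber_strategies G"
    and "\<And>\<sigma>. \<sigma> \<in> cop_strategies G \<Longrightarrow> \<not> captured \<sigma> \<tau> (t + k)"
  shows "\<not> win G k (cop_at \<sigma> \<tau> t) (robber_at \<sigma> \<tau> t)"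
  using captured_hunt[OF assms(1,2)] assms(3)[OF hunt_in_cop_strategies[OF assms(1)]]
  by blast

text \<open>Redirecting the robber's placement to \<open>r\<close> shows that the cop's start must
  be good against every placement, not only the one that \<open>\<tau>\<close> chooses.\<close>

lemma captures_imp_win_initial:
  assumes "\<sigma> \<in> cop_strategies G" "\<tau> \<in> robber_strategies G"
    and "\<And>\<tau>. \<tau> \<in> robber_strategies G \<Longrightarrow> captured \<sigma> \<tau> k"
    and "r \<in> pverts G"
  shows "win G k (\<sigma> []) r"
proof -
  define \<tau>' where "\<tau>' = \<tau>([] := \<lambda>_. r)"
  have \<tau>': "\<tau>' \<in> robber_strategies G"
    using assms(2,4) by (auto simp: robber_strategies_def \<tau>'_def)
  show ?thesis
    using captures_imp_win[OF assms(1) \<tau>', of 0 k] assms(3)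
    by (simp add: cop_at_0 robber_at_0 \<tau>'_def)
qed

text \<open>The guarantee of \<open>\<sigma>\<close> also covers a robber who deviates from
  \<open>\<tau>\<close> only in his reply in round \<open>t + 1\<close>. Hence the cop's move must
  be good against every legal reply, and this is what restricts her choice of move.\<close>

lemma captures_imp_win_after_cop_move:
  assumes "\<sigma> \<in> cop_strategies G" "\<tau> \<in> robber_strategies G"
    and "\<And>\<tau>. \<tau> \<in> robber_strategies G \<Longrightarrow> captured \<sigma> \<tau> (Suc t + k)"
    and "\<not> captured \<sigma> \<tau> t" "\<sigma> (play \<sigma> \<tau> t) \<noteq> robber_at \<sigma> \<tau> t"
    and "r \<in> moves G (robber_at \<sigma> \<tau> t)"
  shows "win G k (\<sigma> (play \<sigma> \<tau> t)) r"
proof -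
  let ?h = "play \<sigma> \<tau> t"
  define \<tau>' where "\<tau>' = \<tau>(?h := \<lambda>_. r)"
  have \<tau>': "\<tau>' \<in> robber_strategies G"
    using assms(2,6) play_neq_Nil[of \<sigma> \<tau> t]
    by (auto simp: robber_strategies_def \<tau>'_def last_play)
  \<comment> \<open>The altered history \<open>?h\<close> has length \<open>t + 1\<close> and is not
    consulted in the first \<open>t\<close> rounds.\<close>
  have h: "play \<sigma> \<tau>' t = ?h"
    by (rule play_cong_robber) (auto simp: \<tau>'_def length_play)
  then have "cop_at \<sigma> \<tau>' t = cop_at \<sigma> \<tau> t" "robber_at \<sigma> \<tau>' t = robber_at \<sigma> \<tau> t"
    by (simp_all add: cop_at_def robber_at_def)
  with h have "cop_at \<sigma> \<tau>' (Suc t) = \<sigma> ?h" "robber_at \<sigma> \<tau>' (Suc t) = r"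
    using assms(4,5) by (simp_all add: cop_at_Suc robber_at_Suc captured_def \<tau>'_def)
  with captures_imp_win[OF assms(1) \<tau>', of "Suc t" k] assms(3) show ?thesis by simp
qed

section \<open>Distance bounds from the lengths of walks\<close>

lemma dist_dg_le:
  assumes "awalk u p v"
  shows "dist_dg G u v \<le> ereal (length p)"
proof -
  have "awalk_cost (\<lambda>_. 1) p = length p"
    by (induction p) auto
  with min_cost_le_walk_cost[OF assms, of "\<lambda>_. 1"] show ?thesis
    by (simp add: dist_dg_def)
qed

lemma dist_dg_ge:
  assumes "\<And>p. awalk u p v \<Longrightarrow> n \<le> length p"
  shows "ereal n \<le> dist_dg G u v"
proof -
  have "awalk_cost (\<lambda>_. 1) p = length p" for p :: "('a \<times> 'a) list"
    by (induction p) auto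
  then show ?thesis
    unfolding dist_dg_def \<mu>_def using assms by (auto intro!: INF_greatest)
qed

end

section \<open>The graph\<close>

text \<open>The arcs of \<open>G8\<close> as a list of out-neighbourhoods, so that quantifiers over
  moves can be evaluated; \<open>moves_G8\<close> makes the link.\<close>

definition out_nbrs :: "nat list list" where
  "out_nbrs = [[2], [6], [1], [1, 5, 6], [3], [1, 2], [0, 4], [3, 4, 6]]"

definition G8 :: "nat pair_pre_digraph" where
  "G8 = \<lparr> pverts = {..<8},
     parcs = {(0,2), (1,6), (2,1), (3,1), (3,5), (3,6), (4,3), (5,1), (5,2), (6,0), (6,4),
       (7,3), (7,4), (7,6)} \<rparr>"

lemma pverts_G8: "pverts G8 = {..<8}"
  and parcs_G8: "parcs G8 = {(0,2), (1,6), (2,1), (3,1), (3,5), (3,6), (4,3), (5,1), (5,2),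
    (6,0), (6,4), (7,3), (7,4), (7,6)}"
  by (simp_all add: G8_def)

lemma less_8: "u < (8::nat) \<longleftrightarrow> u \<in> {0, 1, 2, 3, 4, 5, 6, 7}"
  by (simp add: numeral_eq_Suc less_Suc_eq disj_ac)

lemma oriented_graph_G8: "oriented_graph G8"
proof
  show "finite (pverts G8)" by (simp add: pverts_G8)
  show "finite (parcs G8)" by (simp add: parcs_G8)
next
  fix e assume "e \<in> parcs G8"
  then show "fst e \<in> pverts G8" "snd e \<in> pverts G8" "fst e \<noteq> snd e"
    unfolding parcs_G8 pverts_G8 by auto
next
  fix u v assume "(u, v) \<in> parcs G8"
  then show "(v, u) \<notin> parcs G8"
    unfolding parcs_G8 by (elim insertE) simp_all
qed

interpretation G8: oriented_graph G8
  by (rule oriented_graph_G8)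

text \<open>Entry \<open>(c, r)\<close> is the number of rounds that optimal play takes from cop position \<open>c\<close> and
  robber position \<open>r\<close>; 9 stands for infinity.\<close>

definition rounds :: "nat list list" where
  "rounds =
    [[0, 9, 1, 9, 9, 9, 9, 9],
     [5, 0, 9, 9, 9, 9, 1, 9],
     [9, 1, 0, 9, 9, 9, 9, 9],
     [5, 1, 2, 0, 9, 1, 1, 9],
     [6, 2, 3, 1, 0, 3, 9, 9],
     [9, 1, 1, 9, 9, 0, 9, 9],
     [1, 9, 4, 9, 1, 4, 0, 9],
     [5, 2, 3, 1, 1, 3, 1, 0]]"

lemma rounds_0: "\<forall>c\<in>set [0..<8]. \<forall>r\<in>set [0..<8]. (c = r) = (rounds ! c ! r \<le> 0)"
  by code_simp

text \<open>The table obeys the recursion that defines \<open>win\<close>, checked by evaluation up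
  to five rounds. An entry above 5 therefore claims only that five rounds do not suffice.\<close>

lemma rounds_Suc:
  "\<forall>k\<in>set [0..<5]. \<forall>c\<in>set [0..<8]. \<forall>r\<in>set [0..<8].
     (c = r \<or> (\<exists>c'\<in>set (c # out_nbrs ! c). c' = r \<or>
       (\<forall>r'\<in>set (r # out_nbrs ! r). rounds ! c' ! r' \<le> k))) = (rounds ! c ! r \<le> Suc k)"
  by code_simp

lemma moves_G8:
  assumes "u < 8"
  shows "moves G8 u = set (u # out_nbrs ! u)"
proof -
  have "u = 0 \<or> u = 1 \<or> u = 2 \<or> u = 3 \<or> u = 4 \<or> u = 5 \<or> u = 6 \<or> u = 7"
    using assms less_8 by simp
  then show ?thesis
    by (elim disjE) (simp_all add: moves_def parcs_G8 out_nbrs_def Collect_disj_eq insert_commute)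
qed

lemma win_G8:
  "k \<le> 5 \<Longrightarrow> c < 8 \<Longrightarrow> r < 8 \<Longrightarrow> win G8 k c r \<longleftrightarrow> rounds ! c ! r \<le> k"
proof (induction k arbitrary: c r)
  case 0
  then show ?case using rounds_0 by auto
next
  case (Suc k)
  have "win G8 (Suc k) c r \<longleftrightarrow> c = r \<or> (\<exists>c'\<in>set (c # out_nbrs ! c). c' = r \<or>
       (\<forall>r'\<in>set (r # out_nbrs ! r). win G8 k c' r'))"
    using Suc.prems by (simp only: win.simps moves_G8)
  also have "\<dots> \<longleftrightarrow> c = r \<or> (\<exists>c'\<in>set (c # out_nbrs ! c). c' = r \<or>
       (\<forall>r'\<in>set (r # out_nbrs ! r). rounds ! c' ! r' \<le> k))"
  proof -
    have "x < 8" if "x \<in> set (u # out_nbrs ! u)" "u < 8" for x u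
      using G8.moves_in_verts[of u x] that by (simp add: moves_G8) (simp add: pverts_G8)
    then have "win G8 k c' r' \<longleftrightarrow> rounds ! c' ! r' \<le> k"
      if "c' \<in> set (c # out_nbrs ! c)" "r' \<in> set (r # out_nbrs ! r)" for c' r'
      using Suc.IH Suc.prems that by (meson Suc_leD)
    then show ?thesis by (metis (no_types, lifting))
  qed
  also have "\<dots> \<longleftrightarrow> rounds ! c ! r \<le> Suc k"
    by (rule rounds_Suc[THEN bspec, THEN bspec, THEN bspec]) (use Suc.prems in simp_all)
  finally show ?case .
qed

section \<open>The game on the witness lasts exactly five rounds\<close>

lemma ex_cop_strategy_G8:
  "\<exists>\<sigma>\<in>cop_strategies G8. \<forall>\<tau>\<in>robber_strategies G8. captured \<sigma> \<tau> 5"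
proof (rule G8.ex_cop_strategy[of 7])
  fix r assume "r \<in> pverts G8"
  then have "r < 8" by (simp add: pverts_G8)
  then show "win G8 5 7 r"
    \<comment> \<open>No entry in row 7 exceeds 5.\<close>
    by (simp add: win_G8) (auto simp: less_8 rounds_def)
qed (simp add: pverts_G8)

lemma ex_robber_strategy_G8:
  "\<exists>\<tau>\<in>robber_strategies G8. \<forall>\<sigma>\<in>cop_strategies G8. \<not> captured \<sigma> \<tau> 4"
proof (rule G8.ex_robber_strategy)
  fix c assume "c \<in> pverts G8"
  then have c: "c < 8" by (simp add: pverts_G8)
  \<comment> \<open>Every row has an entry above 4 in one of these columns, so no start allows the
    cop to finish in four rounds.\<close>
  then have "\<exists>r\<in>{0, 1, 3}. r < 8 \<and> \<not> rounds ! c ! r \<le> 4"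
    by (auto simp: less_8 rounds_def)
  then obtain r where "r < 8" "\<not> rounds ! c ! r \<le> 4"
    by blast
  with c show "\<exists>r\<in>pverts G8. \<not> win G8 4 c r"
    by (auto simp: win_G8 pverts_G8)
qed

section \<open>The two distances to be compared\<close>

lemma dist_G8_6_2: "dist_dg G8 6 2 \<le> ereal 2"
proof -
  have "G8.awalk 6 [(6, 0), (0, 2)] 2"
    by (simp add: G8.awalk_Cons_iff G8.awalk_Nil_iff parcs_G8) (simp add: pverts_G8)
  from G8.dist_dg_le[OF this] show ?thesis by simp
qed

lemma dist_G8_4_2: "ereal 3 \<le> dist_dg G8 4 2"
proof -
  have "3 \<le> length p" if "G8.awalk 4 p 2" for p
  proof (rule ccontr)
    \<comment> \<open>All walks with at most two arcs are inspected: apart from 4 itself they reach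
      only 3 and then 1, 5 or 6.\<close>
    assume "\<not> 3 \<le> length p"
    then have "length p = 0 \<or> length p = 1 \<or> length p = 2" by linarith
    then have "p = [] \<or> (\<exists>e. p = [e]) \<or> (\<exists>e e'. p = [e, e'])"
      by (auto simp: length_Suc_conv numeral_2_eq_2)
    then show False
      using that by (auto simp: G8.awalk_Cons_iff G8.awalk_Nil_iff parcs_G8)
  qed
  from G8.dist_dg_ge[of 4 2 3, OF this] show ?thesis by simp
qed

text \<open>Capture by round 5 but not by round 4 forces the position after round \<open>t\<close>
  to need exactly \<open>5 - t\<close> further rounds, for \<open>t\<close> up to 4. In the first
  two rounds the table leaves each player a single move compatible with this.\<close>

lemma optimal_play_G8:
  assumes "optimal_cop G8 \<sigma>" "optimal_robber G8 \<tau>"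
  shows "cop_at \<sigma> \<tau> 1 = 6 \<and> robber_at \<sigma> \<tau> 1 = 2 \<and> cop_at \<sigma> \<tau> 2 = 4 \<and> robber_at \<sigma> \<tau> 2 = 2"
proof -
  have \<sigma>: "\<sigma> \<in> cop_strategies G8" and \<tau>: "\<tau> \<in> robber_strategies G8"
    using assms by (auto simp: optimal_cop_def optimal_robber_def)
  have cap: "captured \<sigma> \<tau>' 5" if "\<tau>' \<in> robber_strategies G8" for \<tau>'
    using G8.optimal_cop_captures[OF assms(1) that ex_cop_strategy_G8] .
  have esc: "\<not> captured \<sigma>' \<tau> 4" if "\<sigma>' \<in> cop_strategies G8" for \<sigma>'
    using G8.optimal_robber_escapes[OF assms(2) that ex_robber_strategy_G8] .
  have nc: "\<not> captured \<sigma> \<tau> t" if "t \<le> 4" for t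
    using esc[OF \<sigma>] captured_mono[OF _ that] by blast
  have lt: "cop_at \<sigma> \<tau> t < 8" "robber_at \<sigma> \<tau> t < 8" for t
    using G8.play_in_verts[OF \<sigma> \<tau>, of t] by (auto simp: pverts_G8)
  define s where "s t = \<sigma> (play \<sigma> \<tau> t)" for t
  \<comment> \<open>After round \<open>t + 1\<close> at most \<open>4 - t\<close> rounds may remain,
    whatever the reply, and the actual reply must make \<open>3 - t\<close> rounds too few.\<close>
  have round: "s t \<in> set (cop_at \<sigma> \<tau> t # out_nbrs ! cop_at \<sigma> \<tau> t)"
    "\<forall>r\<in>set (robber_at \<sigma> \<tau> t # out_nbrs ! robber_at \<sigma> \<tau> t). rounds ! s t ! r \<le> 4 - t"
    "cop_at \<sigma> \<tau> (Suc t) = s t"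
    "robber_at \<sigma> \<tau> (Suc t) \<in> set (robber_at \<sigma> \<tau> t # out_nbrs ! robber_at \<sigma> \<tau> t)"
    "\<not> rounds ! s t ! robber_at \<sigma> \<tau> (Suc t) \<le> 3 - t"
    if t: "t \<le> 3" for t
  proof -
    have ct: "\<not> captured \<sigma> \<tau> t" and cS: "\<not> captured \<sigma> \<tau> (Suc t)"
      using nc t by auto
    show cs: "cop_at \<sigma> \<tau> (Suc t) = s t" using ct by (simp add: cop_at_Suc s_def)
    have "s t \<in> moves G8 (cop_at \<sigma> \<tau> t)"
      unfolding s_def by (rule G8.cop_moves[OF \<sigma> \<tau>])
    then show "s t \<in> set (cop_at \<sigma> \<tau> t # out_nbrs ! cop_at \<sigma> \<tau> t)"
      using lt by (simp add: moves_G8)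
    have ne: "s t \<noteq> robber_at \<sigma> \<tau> t"
      using ct cS by (auto simp: captured_def cop_at_Suc robber_at_Suc s_def)
    have s8: "s t < 8" using lt(1)[of "Suc t"] cs by simp
    then have "robber_at \<sigma> \<tau> (Suc t) \<in> moves G8 (robber_at \<sigma> \<tau> t)"
      using ct ne G8.robber_moves[OF \<sigma> \<tau>, of "s t" t]
      by (simp add: robber_at_Suc pverts_G8 s_def)
    then show "robber_at \<sigma> \<tau> (Suc t) \<in> set (robber_at \<sigma> \<tau> t # out_nbrs ! robber_at \<sigma> \<tau> t)"
      using lt by (simp add: moves_G8)
    have "\<not> win G8 (3 - t) (cop_at \<sigma> \<tau> (Suc t)) (robber_at \<sigma> \<tau> (Suc t))"
      by (rule G8.escapes_imp_not_win[OF \<sigma> \<tau>]) (use esc t in simp)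
    then show "\<not> rounds ! s t ! robber_at \<sigma> \<tau> (Suc t) \<le> 3 - t"
      using lt[of "Suc t"] s8 cs by (simp add: win_G8)
    show "\<forall>r\<in>set (robber_at \<sigma> \<tau> t # out_nbrs ! robber_at \<sigma> \<tau> t). rounds ! s t ! r \<le> 4 - t"
    proof
      fix r assume "r \<in> set (robber_at \<sigma> \<tau> t # out_nbrs ! robber_at \<sigma> \<tau> t)"
      then have r: "r \<in> moves G8 (robber_at \<sigma> \<tau> t)" using lt by (simp add: moves_G8)
      then have r8: "r < 8"
        using G8.moves_in_verts[of "robber_at \<sigma> \<tau> t" r] lt(2)[of t] by (simp add: pverts_G8)
      have "win G8 (4 - t) (\<sigma> (play \<sigma> \<tau> t)) r"
        by (rule G8.captures_imp_win_after_cop_move[OF \<sigma> \<tau> _ ct ne[unfolded s_def] r])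
          (use cap t in simp)
      then show "rounds ! s t ! r \<le> 4 - t"
        using r8 s8 by (simp add: win_G8 s_def)
    qed
  qed
  have c0: "cop_at \<sigma> \<tau> 0 = 7"
  proof -
    have "win G8 5 (cop_at \<sigma> \<tau> 0) r" if "r < 8" for r
      unfolding cop_at_0
      by (rule G8.captures_imp_win_initial[OF \<sigma> \<tau> cap]) (use that in \<open>simp_all add: pverts_G8\<close>)
    then have r: "rounds ! cop_at \<sigma> \<tau> 0 ! r \<le> 5" if "r < 8" for r
      using lt(1)[of 0] that by (simp add: win_G8)
    \<comment> \<open>Every row except row 7 has an entry above 5 in one of the columns 0, 1, 3,
      4.\<close>
    show ?thesis
      using lt(1)[of 0] r[of 0] r[of 1] r[of 3] r[of 4] unfolding less_8
      by (auto simp: rounds_def)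
  qed
  have r0: "robber_at \<sigma> \<tau> 0 = 0"
  proof -
    have "\<not> win G8 4 (cop_at \<sigma> \<tau> 0) (robber_at \<sigma> \<tau> 0)"
      by (rule G8.escapes_imp_not_win[OF \<sigma> \<tau>]) (use esc in simp)
    \<comment> \<open>Column 0 is the only one in which row 7 exceeds 4.\<close>
    then have "\<not> rounds ! 7 ! robber_at \<sigma> \<tau> 0 \<le> 4"
      using c0 lt(2)[of 0] by (simp add: win_G8)
    then show ?thesis
      using lt(2)[of 0] unfolding less_8 by (auto simp: rounds_def)
  qed
  \<comment> \<open>Of the four candidates, 7, 3 and 4 need more than 4 rounds if the robber stays
    at 0.\<close>
  have "s 0 \<in> {7, 3, 4, 6}" "rounds ! s 0 ! 2 \<le> 4" "rounds ! s 0 ! 0 \<le> 4"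
    using round(1,2)[of 0] by (simp_all add: c0 r0 out_nbrs_def)
  then have s0: "s 0 = 6"
    by (auto simp: rounds_def)
  have "robber_at \<sigma> \<tau> 1 \<in> {0, 2}" "\<not> rounds ! 6 ! robber_at \<sigma> \<tau> 1 \<le> 3"
    using round(4,5)[of 0] by (simp_all add: s0 r0 out_nbrs_def)
  then have r1: "robber_at \<sigma> \<tau> 1 = 2"
    by (auto simp: rounds_def)
  have c1: "cop_at \<sigma> \<tau> 1 = 6"
    using round(3)[of 0] by (simp add: s0)
  \<comment> \<open>Staying at 6 fails against a robber who stays at 2, and approaching through 0
    fails against his step to 1.\<close>
  have "s 1 \<in> {6, 0, 4}" "rounds ! s 1 ! 2 \<le> 3" "rounds ! s 1 ! 1 \<le> 3"
    using round(1,2)[of 1] unfolding c1 r1 by (simp_all add: out_nbrs_def)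
  then have s1: "s 1 = 4"
    by (auto simp: rounds_def)
  have "robber_at \<sigma> \<tau> 2 \<in> {1, 2}" "\<not> rounds ! 4 ! robber_at \<sigma> \<tau> 2 \<le> 2"
    using round(4,5)[of 1] unfolding s1 r1 Suc_1 by (simp_all add: out_nbrs_def disj_ac)
  then have r2: "robber_at \<sigma> \<tau> 2 = 2"
    by (auto simp: rounds_def)
  have c2: "cop_at \<sigma> \<tau> 2 = 4"
    using round(3)[of 1] unfolding s1 Suc_1 by simp
  from c1 r1 c2 r2 show ?thesis by blast
qed

theorem theorem29:
  shows "\<exists>G :: nat pair_pre_digraph. oriented_graph G \<and> cop_win G \<and>
    (\<forall>\<sigma> \<tau>. optimal_cop G \<sigma> \<longrightarrow> optimal_robber G \<tau> \<longrightarrow>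
      (\<exists>t\<ge>1. dist_dg G (cop_at \<sigma> \<tau> (t + 1)) (robber_at \<sigma> \<tau> (t + 1))
             > dist_dg G (cop_at \<sigma> \<tau> t) (robber_at \<sigma> \<tau> t)))"
proof (intro exI[of _ G8] conjI allI impI)
  show "oriented_graph G8" by (rule oriented_graph_G8)
  show "cop_win G8" using ex_cop_strategy_G8 by (auto simp: cop_win_def)
  fix \<sigma> \<tau> assume "optimal_cop G8 \<sigma>" "optimal_robber G8 \<tau>"
  note pos = optimal_play_G8[OF this]
  note dist_G8_6_2
  also have "ereal 2 < ereal 3" by simp
  also note dist_G8_4_2
  finally show "\<exists>t\<ge>1. dist_dg G8 (cop_at \<sigma> \<tau> (t + 1)) (robber_at \<sigma> \<tau> (t + 1))
             > dist_dg G8 (cop_at \<sigma> \<tau> t) (robber_at \<sigma> \<tau> t)"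
    \<comment> \<open>Rounds 1 and 2 serve: the positions \<open>(6, 2)\<close> and
      \<open>(4, 2)\<close> are at distance at most 2 and at least 3.\<close>
    using pos by (intro exI[of _ 1]) (simp add: numeral_2_eq_2)
qed

end
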